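(* Let $F$ be the face $(U_{3,4},U_{2,3}^{123})$ of $\Gamma_4$. For real $a,b\ge 0$, the point $\mathbf h=(a,b)\in F$ is entropic if and only if $a+b=\log v$ for some integer $v\ge 1$.
   Context: $N_4=\{1,2,3,4\}$. $\Gamma_4$ is the cone of all polymatroid rank functions on $N_4$. A set function $\mathbf h:2^{N_4}\to\mathbb R$ is called entropic if there is a random vector $(X_1,X_2,X_3,X_4)$, each $X_i$ taking values in a finite set, with $\mathbf h(A)=H(X_A)$ for all $A\subseteq N_4$, where $H$ is Shannon entropy, $X_A=(X_j,j\in A)$ and $\mathbf h(\emptyset)=0$. Logarithms (also in the entropy) are to base $2$. For two (poly)matroids $M_1,M_2$ on $N_4$ with rank functions $\mathbf r_1,\mathbf r_2$, $(M_1,M_2)$ denotes the face $\{a\mathbf r_1+b\mathbf r_2:a,b\ge0\}$ of $\Gamma_4$, and $(a,b)$ denotes the point $a\mathbf r_1+b\mathbf r_2$. $U_{3,4}$ is the uniform matroid on $N_4$ with $\mathbf r(A)=\min\{3,|A|\}$; $U^{123}_{2,3}$ is the matroid on $N_4$ with $\mathbf r(A)=\min\{2,|A\cap\{1,2,3\}|\}$. *)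

theory Defs
  imports "HOL-Probability.Probability"
begin

abbreviation N4 :: "nat set" where
  "N4 \<equiv> {1, 2, 3, 4}"

text \<open>Set functions on the power set of \<open>N4\<close> are total functions of type \<open>nat set \<Rightarrow> real\<close>;
  only their values on subsets of \<open>N4\<close> are relevant.\<close>

definition polymatroid_cone :: "(nat set \<Rightarrow> real) set" where
  "polymatroid_cone = {h. h {} = 0 \<and>
     (\<forall>A B. A \<subseteq> B \<and> B \<subseteq> N4 \<longrightarrow> h A \<le> h B) \<and>
     (\<forall>A B. A \<subseteq> N4 \<and> B \<subseteq> N4 \<longrightarrow> h (A \<union> B) + h (A \<inter> B) \<le> h A + h B)}"

definition U_3_4 :: "nat set \<Rightarrow> real" where
  "U_3_4 A = real (min 3 (card A))"

definition U_2_3_123 :: "nat set \<Rightarrow> real" where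
  "U_2_3_123 A = real (min 2 (card (A \<inter> {1, 2, 3})))"

definition face_point :: "(nat set \<Rightarrow> real) \<Rightarrow> (nat set \<Rightarrow> real) \<Rightarrow> real \<Rightarrow> real \<Rightarrow> nat set \<Rightarrow> real" where
  "face_point r1 r2 a b = (\<lambda>A. a * r1 A + b * r2 A)"

definition pair_face :: "(nat set \<Rightarrow> real) \<Rightarrow> (nat set \<Rightarrow> real) \<Rightarrow> (nat set \<Rightarrow> real) set" where
  "pair_face r1 r2 = {h. \<exists>a\<ge>0. \<exists>b\<ge>0. \<forall>A\<subseteq>N4. h A = face_point r1 r2 a b A}"

definition subvector :: "(nat \<Rightarrow> 'a \<Rightarrow> 'b) \<Rightarrow> nat set \<Rightarrow> 'a \<Rightarrow> nat \<Rightarrow> 'b" where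
  "subvector X A \<omega> = (\<lambda>j\<in>A. X j \<omega>)"

definition shannon_entropy :: "'a measure \<Rightarrow> ('a \<Rightarrow> 'b) \<Rightarrow> real" where
  "shannon_entropy M Y = prob_space.entropy M 2 (count_space (Y ` space M)) Y"

text \<open>Sample space and values are taken in \<open>nat\<close>, because a definition cannot quantify over types.
  This loses no generality; see \<open>entropicI\<close> below.\<close>

definition entropic :: "(nat set \<Rightarrow> real) \<Rightarrow> bool" where
  "entropic h \<longleftrightarrow> h {} = 0 \<and>
     (\<exists>(M :: nat measure) (X :: nat \<Rightarrow> nat \<Rightarrow> nat). prob_space M \<and>
        (\<forall>j\<in>N4. simple_function M (X j)) \<and>
        (\<forall>A\<subseteq>N4. h A = shannon_entropy M (subvector X A)))"

lemma shannon_entropy_eq: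
  assumes "prob_space M" "simple_function M Y"
  shows "shannon_entropy M Y =
    - (\<Sum>y\<in>Y ` space M. measure M (Y -` {y} \<inter> space M) * log 2 (measure M (Y -` {y} \<inter> space M)))"
proof -
  interpret prob_space M by fact
  interpret information_space M 2 by standard simp
  have "simple_distributed M Y (\<lambda>y. prob (Y -` {y} \<inter> space M))"
    by (rule simple_distributedI) (use assms(2) in auto)
  from entropy_simple_distributed[OF this] show ?thesis
    by (simp add: shannon_entropy_def)
qed

lemma entropicI:
  fixes M :: "'a measure" and X :: "nat \<Rightarrow> 'a \<Rightarrow> 'b"
  assumes M: "prob_space M" and X: "\<And>j. j \<in> N4 \<Longrightarrow> simple_function M (X j)"
    and h0: "h {} = 0" and h: "\<And>A. A \<subseteq> N4 \<Longrightarrow> h A = shannon_entropy M (subvector X A)"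
  shows "entropic h"
proof -
  interpret prob_space M by fact
  define Z where "Z = subvector X N4"
  have sub: "simple_function M (subvector X A)" if "A \<subseteq> N4" for A
  proof -
    have *: "finite A" using that finite_subset by blast
    have fin: "finite (subvector X A ` space M)"
    proof (rule finite_subset)
      show "subvector X A ` space M \<subseteq> PiE A (\<lambda>j. X j ` space M)"
        by (auto simp: subvector_def)
      show "finite (PiE A (\<lambda>j. X j ` space M))"
        using that X by (intro finite_PiE *) (auto dest: simple_functionD(1))
    qed
    have "subvector X A -` {y} \<inter> space M \<in> sets M" if y: "y \<in> subvector X A ` space M" for y
    proof -
      have "subvector X A -` {y} \<inter> space M = {w \<in> space M. \<forall>j\<in>A. w \<in> X j -` {y j} \<inter> space M}"
      proof -
        obtain w0 where "y = (\<lambda>j\<in>A. X j w0)" using y by (auto simp: subvector_def)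
        then show ?thesis by (auto simp: subvector_def fun_eq_iff restrict_def) metis
      qed
      also have "\<dots> \<in> sets M"
        using * \<open>A \<subseteq> N4\<close> X by (intro sets.sets_Collect_finite_All) (auto intro!: simple_functionD(2))
      finally show ?thesis .
    qed
    with fin show ?thesis by (auto simp: simple_function_def)
  qed
  have Zs: "simple_function M Z" unfolding Z_def by (rule sub) simp
  define R where "R = Z ` space M"
  have finR: "finite R" using Zs by (simp add: R_def simple_functionD)
  obtain e :: "(nat \<Rightarrow> 'b) \<Rightarrow> nat" where e: "inj_on e R"
    using finite_imp_inj_to_nat_seg[OF finR] by auto
  define V where "V = (\<Union>j\<in>N4. X j ` space M)"
  have finV: "finite V" using X by (auto simp: V_def dest: simple_functionD(1))
  obtain f :: "'b \<Rightarrow> nat" where f: "inj_on f V"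
    using finite_imp_inj_to_nat_seg[OF finV] by auto
  define S where "S = e ` R"
  define N where "N = distr M (count_space S) (e \<circ> Z)"
  have meas: "e \<circ> Z \<in> M \<rightarrow>\<^sub>M count_space S"
  proof (rule measurable_compose[of Z _ "count_space R", unfolded comp_def[symmetric]])
    have "Z \<in> M \<rightarrow>\<^sub>M count_space UNIV" by (rule measurable_simple_function[OF Zs])
    then show "Z \<in> M \<rightarrow>\<^sub>M count_space R" by (auto simp: measurable_def R_def)
    show "e \<in> count_space R \<rightarrow>\<^sub>M count_space S" by (auto simp: S_def)
  qed
  have N: "prob_space N" unfolding N_def by (rule prob_space_distr[OF meas])
  have spN: "space N = S" and seN: "sets N = Pow S" by (auto simp: N_def)
  define X' where "X' = (\<lambda>j n. f (inv_into R e n j))"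
  have finS: "finite S" using finR by (simp add: S_def)
  have sN: "simple_function N g" for g :: "nat \<Rightarrow> 'c"
    using finS by (auto simp: simple_function_def spN seN)
  have ent: "shannon_entropy N (subvector X' A) = shannon_entropy M (subvector X A)" if A: "A \<subseteq> N4" for A
  proof -
    define c :: "(nat \<Rightarrow> 'b) \<Rightarrow> nat \<Rightarrow> nat" where "c = (\<lambda>y. \<lambda>j\<in>A. f (y j))"
    have comp: "subvector X' A (e (Z w)) = c (subvector X A w)" if "w \<in> space M" for w
    proof -
      have "inv_into R e (e (Z w)) = Z w" using e that by (auto simp: R_def intro!: inv_into_f_f)
      then show ?thesis using A
        by (auto simp: subvector_def X'_def c_def Z_def fun_eq_iff restrict_def)
    qed
    have im: "subvector X' A ` space N = c ` subvector X A ` space M"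
      by (force simp: spN S_def R_def comp image_iff)
    have injc: "inj_on c (subvector X A ` space M)"
    proof (rule inj_onI, clarify)
      fix w w' assume w: "w \<in> space M" "w' \<in> space M"
        and eq: "c (subvector X A w) = c (subvector X A w')"
      have "X j w = X j w'" if "j \<in> A" for j
      proof -
        have "f (X j w) = f (X j w')" using fun_cong[OF eq, of j] that by (simp add: c_def subvector_def)
        moreover have "X j w \<in> V" "X j w' \<in> V" using w that A by (auto simp: V_def)
        ultimately show ?thesis using f by (auto dest: inj_onD)
      qed
      then show "subvector X A w = subvector X A w'" by (auto simp: subvector_def)
    qed
    have meq: "measure N (subvector X' A -` {c y} \<inter> space N) = measure M (subvector X A -` {y} \<inter> space M)"
      if y: "y \<in> subvector X A ` space M" for y
    proof -
      have "measure N (subvector X' A -` {c y} \<inter> space N) =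
          measure M ((e \<circ> Z) -` (subvector X' A -` {c y} \<inter> S) \<inter> space M)"
        unfolding N_def by (subst measure_distr[OF meas]) auto
      also have "(e \<circ> Z) -` (subvector X' A -` {c y} \<inter> S) \<inter> space M = subvector X A -` {y} \<inter> space M"
      proof -
        have "e (Z w) \<in> S" if "w \<in> space M" for w using that by (simp add: S_def R_def)
        moreover have "c (subvector X A w) = c y \<longleftrightarrow> subvector X A w = y" if "w \<in> space M" for w
          using inj_on_eq_iff[OF injc] y that by blast
        ultimately show ?thesis using comp by auto
      qed
      finally show ?thesis .
    qed
    show ?thesis
      unfolding shannon_entropy_eq[OF N sN] shannon_entropy_eq[OF M sub[OF A]] im
      by (subst sum.reindex[OF injc]) (simp add: meq)
  qed
  show ?thesis unfolding entropic_def
    using h0 h N sN ent by (intro conjI exI[of _ N] exI[of _ X']) auto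
qed

lemma polymatroid_cone_nonneg_comb:
  assumes "r1 \<in> polymatroid_cone" "r2 \<in> polymatroid_cone" "0 \<le> a" "0 \<le> b"
  shows "face_point r1 r2 a b \<in> polymatroid_cone"
proof -
  have "a * r1 A + b * r2 A \<le> a * r1 B + b * r2 B" if "A \<subseteq> B" "B \<subseteq> N4" for A B
    using assms that by (intro add_mono mult_left_mono) (auto simp: polymatroid_cone_def)
  moreover have "a * r1 (A \<union> B) + b * r2 (A \<union> B) + (a * r1 (A \<inter> B) + b * r2 (A \<inter> B))
      \<le> a * r1 A + b * r2 A + (a * r1 B + b * r2 B)" if "A \<subseteq> N4" "B \<subseteq> N4" for A B
  proof -
    have "a * (r1 (A \<union> B) + r1 (A \<inter> B)) \<le> a * (r1 A + r1 B)"
      "b * (r2 (A \<union> B) + r2 (A \<inter> B)) \<le> b * (r2 A + r2 B)"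
      using assms that by (auto intro!: mult_left_mono simp: polymatroid_cone_def)
    then show ?thesis by (simp add: algebra_simps)
  qed
  ultimately show ?thesis using assms by (auto simp: polymatroid_cone_def face_point_def)
qed

lemma min_card_submodular:
  fixes k :: nat
  assumes "finite A" "finite B"
  shows "min k (card (A \<union> B)) + min k (card (A \<inter> B)) \<le> min k (card A) + min k (card B)"
proof -
  have "card (A \<union> B) + card (A \<inter> B) = card A + card B"
    using card_Un_Int[OF assms] by simp
  moreover have "card (A \<inter> B) \<le> card A" "card (A \<inter> B) \<le> card B"
    using assms by (auto intro: card_mono)
  ultimately show ?thesis by (auto simp: min_def)
qed

lemma U_3_4_in_cone: "U_3_4 \<in> polymatroid_cone"
proof -
  have fin: "finite A" if "A \<subseteq> N4" for A using that finite_subset by blast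
  have "U_3_4 A \<le> U_3_4 B" if "A \<subseteq> B" "B \<subseteq> N4" for A B
    using card_mono[OF fin[OF that(2)] that(1)] by (simp add: U_3_4_def min_def)
  moreover have "U_3_4 (A \<union> B) + U_3_4 (A \<inter> B) \<le> U_3_4 A + U_3_4 B" if "A \<subseteq> N4" "B \<subseteq> N4" for A B
    unfolding U_3_4_def of_nat_add[symmetric] of_nat_le_iff
    by (rule min_card_submodular[OF fin[OF that(1)] fin[OF that(2)]])
  ultimately show ?thesis by (auto simp: polymatroid_cone_def U_3_4_def)
qed

lemma U_2_3_123_in_cone: "U_2_3_123 \<in> polymatroid_cone"
proof -
  have "U_2_3_123 A \<le> U_2_3_123 B" if "A \<subseteq> B" for A B
  proof -
    have "card (A \<inter> {1,2,3}) \<le> card (B \<inter> {1,2,3})"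
      using that by (intro card_mono) auto
    then show ?thesis unfolding U_2_3_123_def by (intro of_nat_mono min.mono order_refl)
  qed
  moreover have "U_2_3_123 (A \<union> B) + U_2_3_123 (A \<inter> B) \<le> U_2_3_123 A + U_2_3_123 B" for A B
    using min_card_submodular[of "A \<inter> {1,2,3}" "B \<inter> {1,2,3}" 2]
    unfolding U_2_3_123_def of_nat_add[symmetric] of_nat_le_iff
    by (simp add: Int_Un_distrib2 Int_ac)
  ultimately show ?thesis by (auto simp: polymatroid_cone_def U_2_3_123_def)
qed

lemma pair_face_subset_cone: "pair_face U_3_4 U_2_3_123 \<subseteq> polymatroid_cone"
proof
  fix h assume "h \<in> pair_face U_3_4 U_2_3_123"
  then obtain a b where ab: "0 \<le> a" "0 \<le> b"
    and h: "\<And>A. A \<subseteq> N4 \<Longrightarrow> h A = face_point U_3_4 U_2_3_123 a b A"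
    unfolding pair_face_def by blast
  have p: "face_point U_3_4 U_2_3_123 a b \<in> polymatroid_cone"
    by (rule polymatroid_cone_nonneg_comb[OF U_3_4_in_cone U_2_3_123_in_cone ab])
  have "h {} = 0" using p h[of "{}"] by (simp add: polymatroid_cone_def)
  moreover have "h A \<le> h B" if "A \<subseteq> B" "B \<subseteq> N4" for A B
    using p that unfolding h[OF that(2)] h[OF order_trans[OF that]] polymatroid_cone_def by blast
  moreover have "h (A \<union> B) + h (A \<inter> B) \<le> h A + h B" if "A \<subseteq> N4" "B \<subseteq> N4" for A B
    using p that
    unfolding h[OF that(1)] h[OF that(2)] h[OF Un_least[OF that]] h[OF le_infI1[OF that(1)]]
      polymatroid_cone_def by blast
  ultimately show "h \<in> polymatroid_cone"
    unfolding polymatroid_cone_def by blast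
qed

text \<open>Together with the inclusion above: \<open>pair_face U_3_4 U_2_3_123\<close> is a face of the cone.\<close>

lemma pair_face_is_face:
  assumes f: "f \<in> polymatroid_cone" and g: "g \<in> polymatroid_cone"
    and fg: "(\<lambda>A. f A + g A) \<in> pair_face U_3_4 U_2_3_123"
  shows "f \<in> pair_face U_3_4 U_2_3_123"
proof -
  obtain a b where ab: "\<And>A. A \<subseteq> N4 \<Longrightarrow> f A + g A = a * U_3_4 A + b * U_2_3_123 A"
    using fg by (auto simp: pair_face_def face_point_def)
  have tight: "f (A \<union> B) + f (A \<inter> B) = f A + f B"
    if "A \<subseteq> N4" "B \<subseteq> N4"
      "U_3_4 (A \<union> B) + U_3_4 (A \<inter> B) = U_3_4 A + U_3_4 B"
      "U_2_3_123 (A \<union> B) + U_2_3_123 (A \<inter> B) = U_2_3_123 A + U_2_3_123 B" for A B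
  proof -
    have "a * (U_3_4 (A \<union> B) + U_3_4 (A \<inter> B)) + b * (U_2_3_123 (A \<union> B) + U_2_3_123 (A \<inter> B))
        = a * (U_3_4 A + U_3_4 B) + b * (U_2_3_123 A + U_2_3_123 B)"
      using that by simp
    then have "(f (A \<union> B) + g (A \<union> B)) + (f (A \<inter> B) + g (A \<inter> B)) = (f A + g A) + (f B + g B)"
      using that(1,2) by (subst (1 2 3 4) ab) (auto simp: algebra_simps)
    moreover have "f (A \<union> B) + f (A \<inter> B) \<le> f A + f B" "g (A \<union> B) + g (A \<inter> B) \<le> g A + g B"
      using f g that(1,2) by (auto simp: polymatroid_cone_def)
    ultimately show ?thesis by linarith
  qed
  have mtight: "f A = f N4" if "A \<subseteq> N4" "U_3_4 A = U_3_4 N4" "U_2_3_123 A = U_2_3_123 N4" for A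
  proof -
    have "f A + g A = f N4 + g N4" using that by (simp add: ab)
    moreover have "f A \<le> f N4" "g A \<le> g N4" using f g that(1) by (auto simp: polymatroid_cone_def)
    ultimately show ?thesis by linarith
  qed
  note U = U_3_4_def U_2_3_123_def Int_insert_left
  have f0: "f {} = 0" using f by (simp add: polymatroid_cone_def)
  have e: "f {1,2} = f {1} + f {2}" "f {1,3} = f {1} + f {3}" "f {2,3} = f {2} + f {3}"
    "f {1,4} = f {1} + f {4}" "f {2,4} = f {2} + f {4}" "f {3,4} = f {3} + f {4}"
    using tight[of "{1}" "{2}"] tight[of "{1}" "{3}"] tight[of "{2}" "{3}"]
      tight[of "{1}" "{4}"] tight[of "{2}" "{4}"] tight[of "{3}" "{4}"] f0
    by (simp_all add: U insert_commute)
  have t: "f {1,2,4} = f {1,2} + f {4}" "f {1,3,4} = f {1,3} + f {4}" "f {2,3,4} = f {2,3} + f {4}"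
    using tight[of "{1,2}" "{4}"] tight[of "{1,3}" "{4}"] tight[of "{2,3}" "{4}"] f0
    by (simp_all add: U insert_commute)
  have m: "f {1,2,3} = f N4" "f {1,2,4} = f N4" "f {1,3,4} = f N4" "f {2,3,4} = f N4"
    by (rule mtight; simp add: U)+
  have "f {1,2,3} + f {} \<le> f {1,2} + f {3}"
  proof -
    have eq: "{1,2,3::nat} = {1,2} \<union> {3}" "({} :: nat set) = {1,2} \<inter> {3}" by auto
    have sub: "f (A \<union> B) + f (A \<inter> B) \<le> f A + f B" if "A \<subseteq> N4" "B \<subseteq> N4" for A B
      using f that by (auto simp: polymatroid_cone_def)
    show ?thesis by (subst eq(1), subst eq(2), rule sub) auto
  qed
  moreover have "f {} \<le> f {4}"
  proof -
    have mono: "f A \<le> f B" if "A \<subseteq> B" "B \<subseteq> N4" for A B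
      using f that by (auto simp: polymatroid_cone_def)
    show ?thesis by (rule mono) auto
  qed
  ultimately have le: "f {4} \<le> f {1}" "0 \<le> f {4}" using e t m f0 by linarith+
  have N: "f N4 = f {1} + f {2} + f {4}" "f {2} = f {1}" "f {3} = f {1}"
    using e t m by linarith+
  have "f A = f {4} * U_3_4 A + (f {1} - f {4}) * U_2_3_123 A" if "A \<subseteq> N4" for A
  proof -
    have "A = {} \<or> A = {1} \<or> A = {2} \<or> A = {3} \<or> A = {4} \<or> A = {1,2} \<or> A = {1,3} \<or> A = {2,3} \<or>
        A = {1,4} \<or> A = {2,4} \<or> A = {3,4} \<or> A = {1,2,3} \<or> A = {1,2,4} \<or> A = {1,3,4} \<or>
        A = {2,3,4} \<or> A = N4"
      using that unfolding Pow_iff[symmetric] Pow_insert Pow_empty image_insert image_empty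
        Un_insert_left Un_empty_left insert_iff empty_iff by argo
    then show ?thesis
      by (elim disjE) (simp_all add: e m N f0 U algebra_simps del: One_nat_def)
  qed
  then have "\<forall>A\<subseteq>N4. f A = face_point U_3_4 U_2_3_123 (f {4}) (f {1} - f {4}) A"
    unfolding face_point_def by blast
  moreover have "0 \<le> f {1} - f {4}" using le(1) by linarith
  ultimately show ?thesis using le(2) unfolding pair_face_def by blast
qed

end

theory Submission
  imports Defs "HOL-Real_Asymp.Real_Asymp" "HOL-Number_Theory.Cong"
begin

text \<open>Necessity: the rank values force each of the triples \<open>X\<^sub>i, X\<^sub>j, X\<^sub>4\<close> with distinct \<open>i\<close>, \<open>j\<close>
  in \<open>{1, 2, 3}\<close> to be independent and to determine the whole vector. Hence every value \<open>x\<close> of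
  \<open>X\<^sub>1\<close> and \<open>y\<close> of \<open>X\<^sub>3\<close> occur together in an outcome, whose probability is
  \<open>p\<^sub>1 p\<^sub>2 p\<^sub>4 = p\<^sub>2 p\<^sub>3 p\<^sub>4\<close>. So \<open>P(X\<^sub>1 = x) = P(X\<^sub>3 = y)\<close> always: \<open>X\<^sub>1\<close> is uniform and
  its entropy \<open>a + b\<close> is the logarithm of its number of values.

  Sufficiency: take independent \<open>X\<^sub>1\<close>, \<open>X\<^sub>2\<close> uniform modulo \<open>v\<close>, \<open>X\<^sub>4 < v\<close> of entropy \<open>a\<close>
  (intermediate value theorem), and \<open>X\<^sub>3 = X\<^sub>1 + X\<^sub>2 + X\<^sub>4\<close> modulo \<open>v\<close>. Any three variables determine
  the fourth and the total entropy is \<open>2 log v + a\<close>, so the bounds \<open>H(X\<^sub>i) \<le> log v\<close> and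
  subadditivity leave no freedom for the remaining entropies.\<close>

section \<open>Marginals and entropies of weight functions on a finite set of outcomes\<close>

definition marginal :: "('a \<Rightarrow> real) \<Rightarrow> 'a set \<Rightarrow> ('a \<Rightarrow> 'b) \<Rightarrow> 'b \<Rightarrow> real" where
  "marginal p S f y = (\<Sum>z\<in>{z \<in> S. f z = y}. p z)"

text \<open>The sum runs over the outcomes in \<open>S\<close> rather than over the values of
  \<open>f\<close>. Entropies of different variables then share one index set and can be added and
  compared termwise.\<close>

definition fin_entropy :: "('a \<Rightarrow> real) \<Rightarrow> 'a set \<Rightarrow> ('a \<Rightarrow> 'b) \<Rightarrow> real" where
  "fin_entropy p S f = - (\<Sum>z\<in>S. p z * log 2 (marginal p S f (f z)))"

lemma sum_marginal_mult:
  assumes "finite S"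
  shows "(\<Sum>z\<in>S. p z * g (f z)) = (\<Sum>y\<in>f ` S. marginal p S f y * g y)"
  by (subst sum.image_gen[OF assms, of _ f])
    (auto simp: marginal_def sum_distrib_right intro!: sum.cong)

lemma sum_marginal: "finite S \<Longrightarrow> (\<Sum>y\<in>f ` S. marginal p S f y) = sum p S"
  using sum_marginal_mult[of S p "\<lambda>_. 1" f] by simp

lemma le_marginal:
  assumes "finite S" "\<And>z. z \<in> S \<Longrightarrow> 0 \<le> p z" "z \<in> S"
  shows "p z \<le> marginal p S f (f z)"
  unfolding marginal_def using assms by (intro member_le_sum) auto

lemma marginal_pos:
  assumes "finite S" "\<And>z. z \<in> S \<Longrightarrow> 0 < p z" "z \<in> S"
  shows "0 < marginal p S f (f z)"
  unfolding marginal_def using assms by (intro sum_pos) auto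

lemma marginal_inj:
  assumes "inj_on f S" "z \<in> S"
  shows "marginal p S f (f z) = p z"
proof -
  have "{z' \<in> S. f z' = f z} = {z}" using assms by (auto dest: inj_onD)
  then show ?thesis by (simp add: marginal_def)
qed

text \<open>Entropy depends on a variable only through the partition it induces.\<close>

lemma fin_entropy_cong_kernel:
  assumes "\<And>z z'. z \<in> S \<Longrightarrow> z' \<in> S \<Longrightarrow> f z = f z' \<longleftrightarrow> g z = g z'"
  shows "fin_entropy p S f = fin_entropy p S g"
proof -
  have "marginal p S f (f z) = marginal p S g (g z)" if "z \<in> S" for z
    unfolding marginal_def using assms that by (intro sum.cong) auto
  then show ?thesis by (simp add: fin_entropy_def)
qed

lemma fin_entropy_inj: "inj_on f S \<Longrightarrow> fin_entropy p S f = - (\<Sum>z\<in>S. p z * log 2 (p z))"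
  by (simp add: fin_entropy_def marginal_inj)

text \<open>Outcomes of weight zero contribute nothing to the marginals or to the outer sum.
  Discarding them provides the strict positivity on which the equality arguments rely.\<close>

lemma fin_entropy_support:
  assumes "finite S" "\<And>z. z \<in> S \<Longrightarrow> 0 \<le> p z"
  shows "fin_entropy p {z \<in> S. 0 < p z} f = fin_entropy p S f"
proof -
  have "marginal p {z \<in> S. 0 < p z} f = marginal p S f"
    unfolding marginal_def using assms
    by (intro ext sum.mono_neutral_left) (auto simp: order.order_iff_strict)
  then show ?thesis
    unfolding fin_entropy_def using assms
    by (simp, intro sum.mono_neutral_left) (auto simp: order.order_iff_strict)
qed

text \<open>Bridge from measures to finite sums: all variables that are functions of one
  \<open>Z\<close> are handled with a single weight function on the range of \<open>Z\<close>. The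
  event that \<open>f \<circ> Z\<close> takes the value \<open>y\<close> splits into the disjoint
  fibres of \<open>Z\<close> over the preimages of \<open>y\<close>.\<close>

lemma shannon_entropy_comp:
  assumes M: "prob_space M" and Z: "simple_function M Z"
  shows "shannon_entropy M (f \<circ> Z) =
    fin_entropy (\<lambda>z. measure M (Z -` {z} \<inter> space M)) (Z ` space M) f"
proof -
  interpret prob_space M by fact
  define R where "R = Z ` space M"
  define p where "p = (\<lambda>z. measure M (Z -` {z} \<inter> space M))"
  have fin: "finite R" using Z by (simp add: R_def simple_functionD)
  have Y: "simple_function M (f \<circ> Z)" using Z by (rule simple_function_compose)
  have P: "measure M ((f \<circ> Z) -` {y} \<inter> space M) = marginal p R f y" for y
  proof -
    have "(f \<circ> Z) -` {y} \<inter> space M = (\<Union>z\<in>{z \<in> R. f z = y}. Z -` {z} \<inter> space M)"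
      by (auto simp: R_def)
    moreover have "measure M \<dots> = (\<Sum>z\<in>{z \<in> R. f z = y}. p z)"
      unfolding p_def using fin Z
      by (intro finite_measure_finite_Union)
        (auto simp: disjoint_family_on_def intro: simple_functionD)
    ultimately show ?thesis by (simp add: marginal_def)
  qed
  have "(f \<circ> Z) ` space M = f ` R" by (auto simp: R_def)
  then have "shannon_entropy M (f \<circ> Z) =
      - (\<Sum>y\<in>f ` R. marginal p R f y * log 2 (marginal p R f y))"
    by (simp only: shannon_entropy_eq[OF M Y] P)
  also have "\<dots> = fin_entropy p R f"
    unfolding fin_entropy_def
    using sum_marginal_mult[OF fin, of p "\<lambda>y. log 2 (marginal p R f y)" f] by simp
  finally show ?thesis by (simp add: R_def p_def)
qed

lemma simple_function_subvector:
  assumes "\<And>j. j \<in> N4 \<Longrightarrow> simple_function M (X j)" "A \<subseteq> N4"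
  shows "simple_function M (subvector X A)"
proof -
  have "simple_function M (\<lambda>\<omega>. (X 1 \<omega>, X 2 \<omega>, X 3 \<omega>, X 4 \<omega>))"
    using assms(1) by (intro simple_function_Pair) auto
  then have "simple_function M ((\<lambda>(x, y, z, w). \<lambda>j\<in>A. if j = 1 then x else if j = 2 then y
      else if j = 3 then z else w) \<circ> (\<lambda>\<omega>. (X 1 \<omega>, X 2 \<omega>, X 3 \<omega>, X 4 \<omega>)))"
    by (rule simple_function_compose)
  also have "(\<lambda>(x, y, z, w). \<lambda>j\<in>A. if j = 1 then x else if j = 2 then y
      else if j = 3 then z else w) \<circ> (\<lambda>\<omega>. (X 1 \<omega>, X 2 \<omega>, X 3 \<omega>, X 4 \<omega>)) = subvector X A"
    using assms(2) by (auto simp: fun_eq_iff subvector_def restrict_def)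
  finally show ?thesis .
qed

section \<open>Equality cases: determination and independence read off from entropy values\<close>

text \<open>By \<open>ln x \<le> x - 1\<close> every defect
  \<open>q z - p z - p z * ln (q z / p z)\<close> is nonnegative, while the hypotheses make their
  sum at most 0. So each defect vanishes, and \<open>ln x = x - 1\<close> holds only at
  \<open>x = 1\<close>.\<close>

lemma gibbs_equality:
  fixes p q :: "'a \<Rightarrow> real"
  assumes fin: "finite S" and pos: "\<And>z. z \<in> S \<Longrightarrow> 0 < p z" "\<And>z. z \<in> S \<Longrightarrow> 0 < q z"
    and le: "sum q S \<le> sum p S"
    and ge: "(\<Sum>z\<in>S. p z * log 2 (p z)) \<le> (\<Sum>z\<in>S. p z * log 2 (q z))"
    and z: "z \<in> S"
  shows "q z = p z"
proof -
  define d where "d = (\<lambda>z. q z - p z - p z * ln (q z / p z))"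
  have d: "0 \<le> d z" if "z \<in> S" for z
  proof -
    have "p z * ln (q z / p z) \<le> p z * (q z / p z - 1)"
      using pos that by (intro mult_left_mono ln_le_minus_one) (auto intro: less_imp_le)
    also have "\<dots> = q z - p z" using pos(1)[OF that] by (simp add: field_simps)
    finally show ?thesis by (simp add: d_def)
  qed
  have "(\<Sum>z\<in>S. p z * ln (q z / p z)) = (\<Sum>z\<in>S. p z * ln (q z)) - (\<Sum>z\<in>S. p z * ln (p z))"
    unfolding sum_subtractf[symmetric] using pos
    by (intro sum.cong) (simp_all add: ln_divide_pos algebra_simps)
  moreover have "(\<Sum>z\<in>S. p z * ln (p z)) \<le> (\<Sum>z\<in>S. p z * ln (q z))"
    using ge by (simp add: log_def sum_divide_distrib[symmetric] divide_right_mono_neg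
        divide_le_cancel)
  ultimately have "sum d S \<le> 0" using le by (simp add: d_def sum_subtractf)
  with d have "sum d S = 0" by (meson order_antisym sum_nonneg)
  then have "d z = 0" using d fin z by (simp add: sum_nonneg_eq_0_iff)
  then have "ln (q z / p z) = q z / p z - 1"
    using pos(1)[OF z] by (simp add: d_def field_simps)
  then have "q z / p z = 1" using pos z by (intro ln_eq_minus_one) auto
  then show ?thesis using pos(1)[OF z] by simp
qed

text \<open>The marginal at \<open>f z\<close> is always at least \<open>p z\<close>, and strictly
  larger when another outcome of positive weight shares the fibre. A collision would therefore make
  the entropy of \<open>f\<close> strictly smaller than that of the whole outcome.\<close>

lemma inj_on_if_entropy_eq:
  fixes p :: "'a \<Rightarrow> real"
  assumes fin: "finite S" and pos: "\<And>z. z \<in> S \<Longrightarrow> 0 < p z"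
    and eq: "fin_entropy p S f = - (\<Sum>z\<in>S. p z * log 2 (p z))"
  shows "inj_on f S"
proof (rule inj_onI, rule ccontr)
  fix x y assume xy: "x \<in> S" "y \<in> S" "f x = f y" "x \<noteq> y"
  have ge: "p z \<le> marginal p S f (f z)" if "z \<in> S" for z
    using le_marginal[OF fin _ that, of p f] pos by (simp add: less_imp_le)
  have "sum p {x, y} \<le> marginal p S f (f x)"
    unfolding marginal_def using xy fin pos
    by (intro sum_mono2) (auto intro: less_imp_le)
  then have less: "p x < marginal p S f (f x)" using xy pos[of y] by simp
  have "(\<Sum>z\<in>S. p z * log 2 (p z)) < (\<Sum>z\<in>S. p z * log 2 (marginal p S f (f z)))"
  proof (rule sum_strict_mono_ex1[OF fin])
    show "\<forall>z\<in>S. p z * log 2 (p z) \<le> p z * log 2 (marginal p S f (f z))"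
    proof
      fix z assume z: "z \<in> S"
      show "p z * log 2 (p z) \<le> p z * log 2 (marginal p S f (f z))"
        using ge[OF z] pos[OF z] by (intro mult_left_mono) auto
    qed
    show "\<exists>z\<in>S. p z * log 2 (p z) < p z * log 2 (marginal p S f (f z))"
      using xy(1) less pos[OF xy(1)] by (intro bexI[of _ x]) auto
  qed
  then show False using eq by (simp add: fin_entropy_def)
qed

text \<open>This is the equality case of Gibbs' inequality against the product of the marginals: it forces the
  product to have full mass on the joint support, which is thus a full product.\<close>

lemma independent_if_entropy_additive:
  fixes p :: "'a \<Rightarrow> real"
  assumes fin: "finite S" and pos: "\<And>z. z \<in> S \<Longrightarrow> 0 < p z" and p1: "sum p S = 1"
    and inj: "inj_on (\<lambda>z. (f z, g z, h z)) S"
    and eq: "fin_entropy p S f + fin_entropy p S g + fin_entropy p S h =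
      - (\<Sum>z\<in>S. p z * log 2 (p z))"
  shows "z \<in> S \<Longrightarrow>
      marginal p S f (f z) * marginal p S g (g z) * marginal p S h (h z) = p z" (is "_ \<Longrightarrow> ?Q z = _")
    and "\<lbrakk>x \<in> S; y \<in> S; w \<in> S\<rbrakk> \<Longrightarrow> \<exists>z\<in>S. f z = f x \<and> g z = g y \<and> h z = h w"
proof -
  let ?P = "f ` S \<times> g ` S \<times> h ` S"
  define q where "q = (\<lambda>(x, y, z). marginal p S f x * marginal p S g y * marginal p S h z)"
  define t where "t = (\<lambda>z. (f z, g z, h z))"
  note mpos = marginal_pos[OF fin, of p, OF pos]
  have qpos: "0 < q u" if "u \<in> ?P" for u
    using that by (auto simp: q_def intro!: mult_pos_pos mpos)
  have sub: "t ` S \<subseteq> ?P" by (auto simp: t_def)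
  have finP: "finite ?P" using fin by simp
  \<comment> \<open>The product of the marginals is a probability on the product of the three
    ranges. Its mass on the image of \<open>S\<close> is thus at most 1, which is the mass bound
    required by \<open>gibbs_equality\<close>.\<close>
  have sumP: "sum q ?P = 1"
    unfolding q_def using fin
    by (simp add: sum.cartesian_product[symmetric] sum_distrib_left[symmetric]
        sum_distrib_right[symmetric] sum_marginal p1 mult.assoc)
  have sumS: "sum q (t ` S) = (\<Sum>z\<in>S. ?Q z)"
    using inj by (simp add: sum.reindex t_def q_def)
  have le: "(\<Sum>z\<in>S. ?Q z) \<le> 1"
    unfolding sumS[symmetric] sumP[symmetric] using finP sub qpos
    by (intro sum_mono2) (auto intro: less_imp_le)
  have eqQ: "?Q z = p z" if "z \<in> S" for z
  proof (rule gibbs_equality[OF fin pos _ _ _ that])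
    show "0 < ?Q z" if "z \<in> S" for z using that by (intro mult_pos_pos mpos)
    show "(\<Sum>z\<in>S. ?Q z) \<le> sum p S" using le p1 by simp
    \<comment> \<open>The logarithm of the product splits into three sums, each of which is minus
      the entropy of one variable.\<close>
    have "(\<Sum>z\<in>S. p z * log 2 (?Q z)) = - (fin_entropy p S f + fin_entropy p S g + fin_entropy p S h)"
      unfolding fin_entropy_def minus_add_distrib minus_minus sum.distrib[symmetric]
      by (intro sum.cong) (simp_all add: log_mult_pos mpos algebra_simps)
    then show "(\<Sum>z\<in>S. p z * log 2 (p z)) \<le> (\<Sum>z\<in>S. p z * log 2 (?Q z))" using eq by simp
  qed
  then show "z \<in> S \<Longrightarrow> ?Q z = p z" .
  have diff: "sum q (?P - t ` S) = 0"
    using sum_diff[OF finP sub, of q] sumP sumS eqQ p1 by simp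
  have "?P - t ` S = {}"
  proof (rule ccontr)
    assume "?P - t ` S \<noteq> {}"
    then have "0 < sum q (?P - t ` S)" using finP qpos by (intro sum_pos) blast+
    then show False using diff by simp
  qed
  then have full: "?P \<subseteq> t ` S" by blast
  show "\<lbrakk>x \<in> S; y \<in> S; w \<in> S\<rbrakk> \<Longrightarrow> \<exists>z\<in>S. f z = f x \<and> g z = g y \<and> h z = h w"
  proof -
    assume "x \<in> S" "y \<in> S" "w \<in> S"
    then have "(f x, g y, h w) \<in> t ` S" using full by blast
    then show ?thesis by (auto simp: t_def)
  qed
qed

section \<open>Necessity: entropic points have \<open>a + b\<close> the logarithm of an
  integer\<close>

text \<open>The marginals over the values of \<open>f\<close> sum to 1, so their common value
  \<open>c\<close> is the reciprocal of the number of values.\<close>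

lemma entropy_log_card_if_uniform:
  assumes fin: "finite S" and p1: "sum p S = 1"
    and c: "\<And>z. z \<in> S \<Longrightarrow> marginal p S f (f z) = c"
  shows "fin_entropy p S f = log 2 (real (card (f ` S)))"
proof -
  have "1 = (\<Sum>y\<in>f ` S. marginal p S f y)" using sum_marginal[OF fin] p1 by metis
  also have "\<dots> = (\<Sum>y\<in>f ` S. c)" using c by (intro sum.cong) auto
  also have "\<dots> = real (card (f ` S)) * c" by simp
  finally have *: "1 = real (card (f ` S)) * c" .
  then have "c = 1 / real (card (f ` S))" by (metis mult_zero_left nonzero_eq_divide_eq mult.commute zero_neq_one)
  moreover have "fin_entropy p S f = - log 2 c"
    by (simp add: fin_entropy_def c sum_distrib_right[symmetric] p1)
  moreover have "card (f ` S) \<noteq> 0" using * by (intro notI) simp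
  ultimately show ?thesis by (simp add: log_divide)
qed

lemma log_card_if_entropic:
  assumes "entropic (face_point U_3_4 U_2_3_123 a b)"
  shows "\<exists>v::nat. 1 \<le> v \<and> a + b = log 2 (real v)"
proof -
  obtain M :: "nat measure" and X :: "nat \<Rightarrow> nat \<Rightarrow> nat" where M: "prob_space M"
    and X: "\<And>j. j \<in> N4 \<Longrightarrow> simple_function M (X j)"
    and h: "\<And>A. A \<subseteq> N4 \<Longrightarrow> face_point U_3_4 U_2_3_123 a b A = shannon_entropy M (subvector X A)"
    using assms by (auto simp: entropic_def)
  interpret prob_space M by fact
  define Z where "Z = subvector X N4"
  have Z: "simple_function M Z" unfolding Z_def by (rule simple_function_subvector[OF X]) auto
  define p where "p = (\<lambda>z. measure M (Z -` {z} \<inter> space M))"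
  \<comment> \<open>Only outcomes of positive probability are kept, so that \<open>S\<close> is the
    exact support of the vector.\<close>
  define S where "S = {z \<in> Z ` space M. 0 < p z}"
  have finR: "finite (Z ` space M)" using Z by (simp add: simple_functionD)
  then have fin: "finite S" by (simp add: S_def)
  have pos: "0 < p z" if "z \<in> S" for z using that by (simp add: S_def)
  have nn: "0 \<le> p z" for z by (simp add: p_def)
  have "sum p (Z ` space M) = measure M (\<Union>z\<in>Z ` space M. Z -` {z} \<inter> space M)"
    unfolding p_def using finR Z
    by (intro finite_measure_finite_Union[symmetric])
      (auto simp: disjoint_family_on_def intro: simple_functionD)
  also have "(\<Union>z\<in>Z ` space M. Z -` {z} \<inter> space M) = space M" by auto
  finally have "sum p (Z ` space M) = 1" by (simp add: prob_space)
  moreover have "sum p S = sum p (Z ` space M)"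
    unfolding S_def using finR nn by (intro sum.mono_neutral_left) (auto simp: order.order_iff_strict)
  ultimately have p1: "sum p S = 1" by simp
  have H: "fin_entropy p S (\<lambda>z. restrict z A) = face_point U_3_4 U_2_3_123 a b A" if "A \<subseteq> N4" for A
  proof -
    have "subvector X A = (\<lambda>z. restrict z A) \<circ> Z"
      using that by (auto simp: Z_def subvector_def fun_eq_iff restrict_def)
    then show ?thesis
      unfolding S_def using that
      by (simp add: fin_entropy_support finR nn h shannon_entropy_comp[OF M Z] p_def)
  qed
  have res: "z \<in> extensional N4" if "z \<in> S" for z
    using that by (auto simp: S_def Z_def subvector_def)
  note U = face_point_def U_3_4_def U_2_3_123_def Int_insert_left
  \<comment> \<open>Elements of \<open>S\<close> are extensional on \<open>N4\<close>, so
    restricting to \<open>N4\<close> changes nothing and gives the entropy of the whole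
    vector.\<close>
  have total: "fin_entropy p S (\<lambda>z. restrict z N4) = - (\<Sum>z\<in>S. p z * log 2 (p z))"
    by (intro fin_entropy_inj inj_onI) (metis extensional_restrict res)
  then have tot: "- (\<Sum>z\<in>S. p z * log 2 (p z)) = 3 * a + 2 * b"
    using H[of N4] by (simp add: U)
  have single: "fin_entropy p S (\<lambda>z. z j) = face_point U_3_4 U_2_3_123 a b {j}" if "j \<in> N4" for j
  proof -
    have "fin_entropy p S (\<lambda>z. z j) = fin_entropy p S (\<lambda>z. restrict z {j})"
      by (rule fin_entropy_cong_kernel) (auto simp: fun_eq_iff restrict_def)
    then show ?thesis using H that by auto
  qed
  have s: "fin_entropy p S (\<lambda>z. z 1) = a + b" "fin_entropy p S (\<lambda>z. z 2) = a + b"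
    "fin_entropy p S (\<lambda>z. z 3) = a + b" "fin_entropy p S (\<lambda>z. z 4) = a"
    using single[of 1] single[of 2] single[of 3] single[of 4] by (simp_all add: U)
  have inj: "inj_on (\<lambda>z. (z i, z j, z 4)) S"
    if "i \<in> {1,2,3}" "j \<in> {1,2,3}" "i \<noteq> j" for i j
  proof -
    \<comment> \<open>In both matroids \<open>{i, j, 4}\<close> has the rank of \<open>N4\<close>,
      so this subvector already carries the total entropy and determines the outcome.\<close>
    have "card {i, j, 4} = 3" "card ({i, j, 4} \<inter> {1,2,3}) = 2" "{i, j, 4} \<subseteq> N4"
      using that by (auto simp: Int_insert_left)
    then have e: "fin_entropy p S (\<lambda>z. restrict z {i, j, 4}) = - (\<Sum>z\<in>S. p z * log 2 (p z))"
      by (subst H) (simp_all add: tot face_point_def U_3_4_def U_2_3_123_def)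
    have *: "inj_on (\<lambda>z. restrict z {i, j, 4}) S"
      by (rule inj_on_if_entropy_eq[OF fin pos e])
    show ?thesis
    proof (rule inj_onI)
      fix x y assume xy: "x \<in> S" "y \<in> S" "(x i, x j, x 4) = (y i, y j, y 4)"
      then have "restrict x {i, j, 4} = restrict y {i, j, 4}" by (intro restrict_ext) auto
      then show "x = y" using inj_onD[OF * _ xy(1,2)] by simp
    qed
  qed
  \<comment> \<open>The three single entropies are \<open>a + b\<close>, \<open>a + b\<close> and
    \<open>a\<close>, with sum \<open>3 * a + 2 * b\<close>.\<close>
  have add: "fin_entropy p S (\<lambda>z. z i) + fin_entropy p S (\<lambda>z. z j) + fin_entropy p S (\<lambda>z. z 4)
      = - (\<Sum>z\<in>S. p z * log 2 (p z))" if "i \<in> {1,2,3}" "j \<in> {1,2,3}" for i j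
    unfolding tot using that s by auto
  define m where "m = (\<lambda>j z. marginal p S (\<lambda>z. z j) (z j))"
  have prod: "m i z * m j z * m 4 z = p z"
    if "i \<in> {1,2,3}" "j \<in> {1,2,3}" "i \<noteq> j" "z \<in> S" for i j z
    unfolding m_def
    by (rule independent_if_entropy_additive(1)[OF fin pos p1 inj[OF that(1-3)] add[OF that(1,2)] that(4)])
  obtain w where w: "w \<in> S" using p1 by force
  have "m 1 x = m 3 w" if x: "x \<in> S" for x
  proof -
    \<comment> \<open>The support is a full product in the coordinates 1, 3 and 4, so a first
      coordinate from \<open>x\<close> can be combined with a third one from \<open>w\<close>.
      Factoring \<open>p z\<close> in two ways then allows the positive factor
      \<open>m 2 z * m 4 z\<close> to be cancelled.\<close>
    obtain z where z: "z \<in> S" "z 1 = x 1" "z 3 = w 3"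
      using independent_if_entropy_additive(2)[OF fin pos p1 inj[of 1 3] add[of 1 3] x w w] by auto
    have "m 1 z * m 2 z * m 4 z = p z" "m 2 z * m 3 z * m 4 z = p z"
      using prod[of 1 2 z] prod[of 2 3 z] z by auto
    moreover from this have "m 2 z * m 4 z \<noteq> 0" using pos[OF z(1)] by auto
    moreover have "m 1 z * m 2 z * m 4 z = m 1 z * (m 2 z * m 4 z)"
      "m 2 z * m 3 z * m 4 z = m 3 z * (m 2 z * m 4 z)" by simp_all
    ultimately have "m 1 z = m 3 z" by (metis mult_right_cancel)
    then show ?thesis using z by (simp add: m_def)
  qed
  then have "fin_entropy p S (\<lambda>z. z 1) = log 2 (real (card ((\<lambda>z. z 1) ` S)))"
    by (intro entropy_log_card_if_uniform[OF fin p1]) (simp add: m_def)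
  moreover have "1 \<le> card ((\<lambda>z. z 1) ` S)" using w fin
    by (auto simp: Suc_le_eq card_gt_0_iff)
  ultimately show ?thesis using s(1) by auto
qed

section \<open>Shannon inequalities for simple functions\<close>

lemma shannon_entropy_cong:
  assumes "prob_space M" "simple_function M Y" "\<And>\<omega>. \<omega> \<in> space M \<Longrightarrow> Y \<omega> = Y' \<omega>"
  shows "shannon_entropy M Y = shannon_entropy M Y'"
proof -
  have "simple_function M Y'" using assms(2,3) simple_function_cong by blast
  moreover have "Y ` space M = Y' ` space M" using assms(3) by auto
  moreover have "Y -` {y} \<inter> space M = Y' -` {y} \<inter> space M" for y using assms(3) by auto
  ultimately show ?thesis by (simp add: shannon_entropy_eq[OF assms(1)] assms(2))
qed

text \<open>Picking a representative outcome for each value of \<open>X\<close> factors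
  \<open>Y\<close> through \<open>X\<close>; the determinacy hypothesis makes the choice harmless.
  Data processing does the rest.\<close>

lemma shannon_entropy_le_if_function_of:
  assumes M: "prob_space M" and X: "simple_function M X" and Y: "simple_function M Y"
    and det: "\<And>\<omega> \<omega>'. \<omega> \<in> space M \<Longrightarrow> \<omega>' \<in> space M \<Longrightarrow> X \<omega> = X \<omega>' \<Longrightarrow> Y \<omega> = Y \<omega>'"
  shows "shannon_entropy M Y \<le> shannon_entropy M X"
proof -
  interpret prob_space M by fact
  interpret information_space M 2 by standard simp
  define f where "f = (\<lambda>x. Y (SOME \<omega>. \<omega> \<in> space M \<and> X \<omega> = x))"
  have "Y \<omega> = (f \<circ> X) \<omega>" if "\<omega> \<in> space M" for \<omega>
  proof -
    have "(SOME \<omega>'. \<omega>' \<in> space M \<and> X \<omega>' = X \<omega>) \<in> space M \<and>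
        X (SOME \<omega>'. \<omega>' \<in> space M \<and> X \<omega>' = X \<omega>) = X \<omega>"
      by (rule someI[of _ \<omega>]) (simp add: that)
    then show ?thesis unfolding f_def comp_def using det[OF that] by metis
  qed
  then have "shannon_entropy M Y = shannon_entropy M (f \<circ> X)"
    by (rule shannon_entropy_cong[OF M Y])
  also have "\<dots> \<le> shannon_entropy M X"
    unfolding shannon_entropy_def by (rule entropy_data_processing[OF X])
  finally show ?thesis .
qed

text \<open>Chain rule plus the fact that conditioning does not increase entropy. Stating it for any
  \<open>Z\<close> determined by \<open>X\<close> and \<open>Y\<close> lets it apply directly to the
  subvector of a union of index sets.\<close>

lemma shannon_entropy_subadditive:
  assumes M: "prob_space M" and X: "simple_function M X" and Y: "simple_function M Y"
    and Z: "simple_function M Z"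
    and det: "\<And>\<omega> \<omega>'. \<omega> \<in> space M \<Longrightarrow> \<omega>' \<in> space M \<Longrightarrow> X \<omega> = X \<omega>' \<Longrightarrow> Y \<omega> = Y \<omega>' \<Longrightarrow> Z \<omega> = Z \<omega>'"
  shows "shannon_entropy M Z \<le> shannon_entropy M X + shannon_entropy M Y"
proof -
  interpret prob_space M by fact
  interpret information_space M 2 by standard simp
  have "shannon_entropy M Z \<le> shannon_entropy M (\<lambda>\<omega>. (X \<omega>, Y \<omega>))"
  proof (rule shannon_entropy_le_if_function_of[OF M simple_function_Pair[OF X Y] Z])
    fix \<omega> \<omega>' assume "\<omega> \<in> space M" "\<omega>' \<in> space M" "(X \<omega>, Y \<omega>) = (X \<omega>', Y \<omega>')"
    then show "Z \<omega> = Z \<omega>'" using det[of \<omega> \<omega>'] by simp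
  qed
  also have "\<dots> \<le> shannon_entropy M X + shannon_entropy M Y"
    unfolding shannon_entropy_def
    using entropy_chain_rule[OF X Y] conditional_entropy_less_eq_entropy[OF Y X] by simp
  finally show ?thesis .
qed

lemma shannon_entropy_le_log_card:
  assumes M: "prob_space M" and X: "simple_function M X" and V: "X ` space M \<subseteq> V" "finite V"
  shows "shannon_entropy M X \<le> log 2 (real (card V))"
proof -
  interpret prob_space M by fact
  interpret information_space M 2 by standard simp
  have "shannon_entropy M X \<le> log 2 (real (card (X ` space M)))"
    unfolding shannon_entropy_def
    by (rule entropy_le_card[OF simple_distributedI[OF X measure_nonneg refl]])
  also have "\<dots> \<le> log 2 (real (card V))"
  proof -
    have "card (X ` space M) \<le> card V" using V by (intro card_mono)
    moreover have "card (X ` space M) \<noteq> 0"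
      using X not_empty by (simp add: simple_functionD)
    ultimately show ?thesis by simp
  qed
  finally show ?thesis .
qed

section \<open>Sufficiency: a random vector with the prescribed entropies\<close>

text \<open>Only the point 0 needs care: \<open>x * log 2 x\<close> tends to 0 from the right, which
  agrees with its value there because of the factor \<open>x\<close>.\<close>

lemma continuous_on_mult_log: "continuous_on {0..} (\<lambda>x::real. x * log 2 x)"
proof -
  have "continuous (at x within {0..}) (\<lambda>x::real. x * log 2 x)" if "0 \<le> x" for x :: real
  proof (cases "x = 0")
    case True
    have "((\<lambda>x::real. x * log 2 x) \<longlongrightarrow> 0) (at_right 0)" by real_asymp
    then have "((\<lambda>x::real. x * log 2 x) \<longlongrightarrow> 0) (at 0 within {0..})"
      by (simp add: at_within_Ici_at_right)
    then show ?thesis using True by (simp add: continuous_within)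
  next
    case False
    then show ?thesis using that by (intro continuous_intros) auto
  qed
  then show ?thesis by (simp add: continuous_on_eq_continuous_within)
qed

lemma exists_distribution_with_entropy:
  fixes a :: real and v :: nat
  assumes v: "1 \<le> v" and a: "0 \<le> a" "a \<le> log 2 (real v)"
  shows "\<exists>q. (\<forall>k<v. 0 \<le> q k) \<and> (\<Sum>k<v. q k) = 1 \<and> - (\<Sum>k<v. q k * log 2 (q k)) = a"
proof -
  \<comment> \<open>interpolates between a point mass and the uniform distribution\<close>
  define q :: "real \<Rightarrow> nat \<Rightarrow> real" where "q = (\<lambda>t k. (1 - t) * (if k = 0 then 1 else 0) + t / real v)"
  define e where "e = (\<lambda>t. - (\<Sum>k<v. q t k * log 2 (q t k)))"
  have nn: "0 \<le> q t k" if "t \<in> {0..1}" for t k using that by (simp add: q_def)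
  have "continuous_on {0..1} (\<lambda>t. q t k * log 2 (q t k))" for k
  proof (rule continuous_on_compose2[OF continuous_on_mult_log])
    show "continuous_on {0..1} (\<lambda>t. q t k)" unfolding q_def using v by (intro continuous_intros) auto
    show "(\<lambda>t. q t k) ` {0..1} \<subseteq> {0..}" using nn by auto
  qed
  then have "continuous_on {0..1} e" unfolding e_def by (intro continuous_on_minus continuous_on_sum)
  \<comment> \<open>At \<open>t = 0\<close> all weights are 0 or 1, and \<open>x * log 2 x\<close>
    vanishes at both.\<close>
  moreover have "e 0 = 0" by (auto simp: e_def q_def intro!: sum.neutral)
  moreover have "e 1 = log 2 (real v)" using v by (simp add: e_def q_def log_divide)
  ultimately obtain t where t: "0 \<le> t" "t \<le> 1" "e t = a"
    using IVT'[of e 0 a 1] a by auto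
  have "(\<Sum>k<v. q t k) = 1"
    using v by (simp add: q_def sum.distrib sum_distrib_left[symmetric])
  then show ?thesis using nn[of t] t by (intro exI[of _ "q t"]) (auto simp: e_def)
qed

lemma entropic_if_log_card:
  fixes a b :: real
  assumes a: "0 \<le> a" and b: "0 \<le> b" and v: "1 \<le> v" and ab: "a + b = log 2 (real v)"
  shows "entropic (face_point U_3_4 U_2_3_123 a b)"
proof -
  obtain q where qnn: "\<And>k. k < v \<Longrightarrow> 0 \<le> q k" and q1: "(\<Sum>k<v. q k) = 1"
    and qa: "- (\<Sum>k<v. q k * log 2 (q k)) = a"
    using exists_distribution_with_entropy[OF v a] b ab by auto
  define S where "S = {..<v} \<times> {..<v} \<times> {..<v}"
  \<comment> \<open>An outcome \<open>(i, j, k)\<close> holds the values of variables 1, 2 and 4;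
    the first two are uniform and the last has law \<open>q\<close>.\<close>
  define p :: "nat \<times> nat \<times> nat \<Rightarrow> real" where "p = (\<lambda>(i, j, k). q k / (real v)^2)"
  define M where "M = point_measure S (\<lambda>s. ennreal (p s))"
  define X :: "nat \<Rightarrow> nat \<times> nat \<times> nat \<Rightarrow> nat" where
    "X = (\<lambda>n (i, j, k). if n = 1 then i else if n = 2 then j
      else if n = 3 then (i + j + k) mod v else k)"
  have fin: "finite S" by (simp add: S_def)
  have pnn: "0 \<le> p s" if "s \<in> S" for s using that qnn by (auto simp: S_def p_def)
  have sumS: "(\<Sum>s\<in>S. f s) = (\<Sum>i<v. \<Sum>j<v. \<Sum>k<v. f (i, j, k))" for f :: "_ \<Rightarrow> real"
    by (simp add: S_def sum.cartesian_product)
  have p1: "sum p S = 1"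
    using v by (simp add: sumS p_def sum_divide_distrib[symmetric] q1 power2_eq_square)
  have M: "prob_space M"
    unfolding M_def using p1 pnn fin by (intro prob_space_point_measure) auto
  have sp: "space M = S" by (simp add: M_def space_point_measure)
  have simple: "simple_function M f" for f :: "_ \<Rightarrow> 'z"
    using fin by (simp add: M_def)
  have ent: "shannon_entropy M f = fin_entropy p S f" for f :: "_ \<Rightarrow> 'z"
  proof -
    have "measure M ((\<lambda>s. s) -` {s} \<inter> space M) = p s" if "s \<in> S" for s
      using that fin pnn by (simp add: M_def space_point_measure measure_point_measure_finite_if)
    then have "fin_entropy (\<lambda>s. measure M ((\<lambda>s. s) -` {s} \<inter> space M)) S f = fin_entropy p S f"
      unfolding fin_entropy_def marginal_def by (intro arg_cong[of _ _ uminus] sum.cong) auto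
    then show ?thesis
      using shannon_entropy_comp[OF M simple, of f "\<lambda>s. s"] by (simp add: sp comp_def)
  qed
  define E where "E = (\<lambda>A. shannon_entropy M (subvector X A))"
  have cancel: "x = y" if "x < v" "y < v" "(x + c) mod v = (y + c) mod v" for x y c
  proof -
    have "[x + c = y + c] (mod v)" using that by (simp add: cong_def)
    then have "[x = y] (mod v)" by (simp add: cong_add_rcancel_nat)
    then show ?thesis using that by (simp add: cong_def)
  qed
  have sv: "subvector X A s = subvector X A s' \<longleftrightarrow> (\<forall>n\<in>A. X n s = X n s')" for A s s'
    by (auto simp: subvector_def fun_eq_iff restrict_def)
  have mono: "E A \<le> E B"
    if "\<And>s s'. s \<in> S \<Longrightarrow> s' \<in> S \<Longrightarrow> (\<forall>n\<in>B. X n s = X n s') \<Longrightarrow>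
      (\<forall>n\<in>A. X n s = X n s')" for A B
    unfolding E_def
  proof (rule shannon_entropy_le_if_function_of[OF M simple simple])
    fix s s' assume "s \<in> space M" "s' \<in> space M" "subvector X B s = subvector X B s'"
    then show "subvector X A s = subvector X A s'" using that[of s s'] by (simp add: sp sv)
  qed
  have subadd: "E (A \<union> B) \<le> E A + E B" for A B
    unfolding E_def
    by (rule shannon_entropy_subadditive[OF M simple simple simple]) (auto simp: sv)
  \<comment> \<open>Only upper bounds are shown here; they become equalities once the total entropy
    is known.\<close>
  have one: "E {n} \<le> a + b" if "n \<in> {1, 2, 3}" for n
  proof -
    have "E {n} \<le> shannon_entropy M (X n)"
      unfolding E_def
      by (rule shannon_entropy_le_if_function_of[OF M simple simple]) (auto simp: sv)
    also have "\<dots> \<le> log 2 (real (card {..<v}))"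
      using that v by (intro shannon_entropy_le_log_card[OF M simple]) (auto simp: sp S_def X_def)
    finally show ?thesis by (simp add: ab)
  qed
  \<comment> \<open>Each variable is determined by the other three, by cancellation modulo
    \<open>v\<close> among residues below \<open>v\<close>.\<close>
  have triples: "E {1,2,3} = E N4" "E {1,2,4} = E N4" "E {1,3,4} = E N4" "E {2,3,4} = E N4"
  proof -
    have c3: "k = k'" if "(i + j + k) mod v = (i + j + k') mod v" "k < v" "k' < v" for i j k k'
      using cancel[of k k' "i + j"] that by (simp add: ac_simps)
    have c2: "j = j'" if "(i + j + k) mod v = (i + j' + k) mod v" "j < v" "j' < v" for i j j' k
      using cancel[of j j' "i + k"] that by (simp add: ac_simps)
    have c1: "i = i'" if "(i + j + k) mod v = (i' + j + k) mod v" "i < v" "i' < v" for i i' j k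
      using cancel[of i i' "j + k"] that by (simp add: ac_simps)
    have "E N4 \<le> E {1,2,3}"
      by (rule mono) (auto simp: S_def X_def dest: c3)
    moreover have "E N4 \<le> E {1,2,4}"
      by (rule mono) (auto simp: S_def X_def)
    moreover have "E N4 \<le> E {1,3,4}"
      by (rule mono) (auto simp: S_def X_def dest: c2)
    moreover have "E N4 \<le> E {2,3,4}"
      by (rule mono) (auto simp: S_def X_def dest: c1)
    moreover have "E A \<le> E N4" if "A \<subseteq> N4" for A using that by (intro mono) blast
    ultimately show "E {1,2,3} = E N4" "E {1,2,4} = E N4" "E {1,3,4} = E N4" "E {2,3,4} = E N4"
      by (simp_all add: order_antisym)
  qed
  have E0: "E {} = 0"
  proof -
    \<comment> \<open>The empty subvector is the constant function \<open>undefined\<close>, so its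
      range has one element and the bound is \<open>log 2 1 = 0\<close>.\<close>
    have "E {} \<le> log 2 (real (card {\<lambda>_ :: nat. undefined :: nat}))"
      unfolding E_def by (rule shannon_entropy_le_log_card[OF M simple]) (auto simp: subvector_def)
    moreover have "0 \<le> E {}" using subadd[of "{}" "{}"] by simp
    ultimately show ?thesis by simp
  qed
  have E4: "E {4} = a"
  proof -
    have "E {4} = fin_entropy p S (\<lambda>(i, j, k). k)"
      unfolding E_def ent by (rule fin_entropy_cong_kernel, simp only: sv) (auto simp: X_def)
    moreover have "marginal p S (\<lambda>(i, j, k). k) k = q k" if "k < v" for k
    proof -
      have "marginal p S (\<lambda>(i, j, k). k) k = (\<Sum>s\<in>S. if (case s of (i, j, k) \<Rightarrow> k) = k then p s else 0)"
        unfolding marginal_def by (rule sum.inter_filter[OF fin])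
      also have "\<dots> = q k" using v that by (simp add: sumS p_def power2_eq_square)
      finally show ?thesis .
    qed
    ultimately show ?thesis
      using v qa by (simp add: fin_entropy_def sumS p_def power2_eq_square
          sum_divide_distrib[symmetric] times_divide_eq_left)
  qed
  have EN: "E N4 = 3 * a + 2 * b"
  proof -
    have "E N4 = - (\<Sum>s\<in>S. p s * log 2 (p s))"
      unfolding E_def ent
      by (rule fin_entropy_inj, simp only: inj_on_def sv) (auto simp: X_def)
    also have "(\<Sum>s\<in>S. p s * log 2 (p s)) =
        (\<Sum>i<v. \<Sum>j<v. \<Sum>k<v. (q k * log 2 (q k) - q k * (2 * (a + b))) / (real v)^2)"
      unfolding sumS
    proof (intro sum.cong refl)
      fix i j k assume "k \<in> {..<v}"
      \<comment> \<open>For positive \<open>q k\<close> the logarithm of the quotient splits, with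
        \<open>log 2 (v^2) = 2 * (a + b)\<close>; for \<open>q k = 0\<close> both sides are
        0.\<close>
      then have "q k = 0 \<or> 0 < q k" using qnn[of k] by auto
      then show "p (i, j, k) * log 2 (p (i, j, k)) =
          (q k * log 2 (q k) - q k * (2 * (a + b))) / (real v)^2"
        using v by (auto simp: p_def log_divide_pos log_nat_power ab algebra_simps)
    qed
    also have "\<dots> = - a - 2 * (a + b)"
      using v qa by (simp add: sum_divide_distrib[symmetric] sum_subtractf
          sum_distrib_right[symmetric] q1 power2_eq_square)
    finally show ?thesis by simp
  qed
  have "E A = face_point U_3_4 U_2_3_123 a b A" if "A \<subseteq> N4" for A
  proof -
    note o = one[of 1, simplified] one[of 2, simplified] one[of 3, simplified]
    have d: "E {1,2} \<le> E {1} + E {2}" "E {1,3} \<le> E {1} + E {3}" "E {2,3} \<le> E {2} + E {3}"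
      "E {1,4} \<le> E {1} + E {4}" "E {2,4} \<le> E {2} + E {4}" "E {3,4} \<le> E {3} + E {4}"
      using subadd[of "{1}" "{2}"] subadd[of "{1}" "{3}"] subadd[of "{2}" "{3}"]
        subadd[of "{1}" "{4}"] subadd[of "{2}" "{4}"] subadd[of "{3}" "{4}"]
      by (simp_all add: insert_commute)
    have t: "E {1,2,4} \<le> E {1,2} + E {4}" "E {1,3,4} \<le> E {1,3} + E {4}"
      "E {2,3,4} \<le> E {2,3} + E {4}" "E {1,2,4} \<le> E {1,4} + E {2}" "E {1,2,4} \<le> E {2,4} + E {1}"
      "E {1,3,4} \<le> E {3,4} + E {1}"
      using subadd[of "{1,2}" "{4}"] subadd[of "{1,3}" "{4}"] subadd[of "{2,3}" "{4}"]
        subadd[of "{1,4}" "{2}"] subadd[of "{2,4}" "{1}"] subadd[of "{3,4}" "{1}"]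
      by (simp_all add: insert_commute)
    \<comment> \<open>The total \<open>3 * a + 2 * b\<close> equals the sum of the upper bounds for
      each of the triples \<open>{1,2,4}\<close>, \<open>{1,3,4}\<close> and \<open>{2,3,4}\<close>.
      Every subadditivity step leading to it is therefore tight, which fixes all singles and
      pairs.\<close>
    have e: "E {1} = a + b" "E {2} = a + b" "E {3} = a + b"
      "E {1,2} = 2 * a + 2 * b" "E {1,3} = 2 * a + 2 * b" "E {2,3} = 2 * a + 2 * b"
      "E {1,4} = 2 * a + b" "E {2,4} = 2 * a + b" "E {3,4} = 2 * a + b"
      using o[folded One_nat_def] d t triples EN E4 by linarith+
    have "A = {} \<or> A = {1} \<or> A = {2} \<or> A = {3} \<or> A = {4} \<or> A = {1,2} \<or> A = {1,3} \<or> A = {2,3} \<or>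
        A = {1,4} \<or> A = {2,4} \<or> A = {3,4} \<or> A = {1,2,3} \<or> A = {1,2,4} \<or> A = {1,3,4} \<or>
        A = {2,3,4} \<or> A = N4"
      using that unfolding Pow_iff[symmetric] Pow_insert Pow_empty image_insert image_empty
        Un_insert_left Un_empty_left insert_iff empty_iff by argo
    then show ?thesis
      by (elim disjE) (simp_all add: E0 E4 EN e triples face_point_def U_3_4_def U_2_3_123_def
          Int_insert_left algebra_simps del: One_nat_def)
  qed
  then show ?thesis
    \<comment> \<open>\<open>entropicI\<close> transports the construction from triples of naturals
      to the sample space \<open>nat\<close> required by \<open>entropic\<close>.\<close>
    by (intro entropicI[OF M, of X]) (auto simp: simple E_def face_point_def U_3_4_def U_2_3_123_def)
qed

theorem mainTheorem15:
  fixes a b :: real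
  assumes "0 \<le> a" and "0 \<le> b"
  shows "entropic (face_point U_3_4 U_2_3_123 a b) \<longleftrightarrow>
    (\<exists>v::nat. 1 \<le> v \<and> a + b = log 2 (real v))"
  using entropic_if_log_card[OF assms] log_card_if_entropic by blast

end
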